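(* Let $\mathsf{A}\in\mathbb{R}^{J_1\times I_1\times\cdots\times J_N\times I_N}$ be an even-order paired tensor given in CPD format with CP rank equal to $R$ and factor matrices $\mathbf{A}^{(1)},\dots,\mathbf{A}^{(2N)}$. If $k_{\mathbf{A}^{(n)}}\ge 1$ for every $n=1,\dots,2N$ and $$\sum_{n\in\{1,3,\dots,2N-1\}}k_{\mathbf{A}^{(n)}}\ge R+N-1,\qquad \sum_{n\in\{2,4,\dots,2N\}}k_{\mathbf{A}^{(n)}}\ge R+N-1,$$ then $\operatorname{rank}_U(\mathsf{A})=R$.
   Context: An even-order paired tensor is a $2N$-th order real tensor with entries written $\mathsf{A}_{j_1i_1\cdots j_Ni_N}$. The unfolding $\varphi(\mathsf{A})$ is the $\prod_n J_n\times\prod_n I_n$ matrix whose rows are indexed by $(j_1,\dots,j_N)$ and whose columns are indexed by $(i_1,\dots,i_N)$ (both enumerated with the first index varying fastest), with entry $\mathsf{A}_{j_1i_1\cdots j_Ni_N}$; $\operatorname{rank}_U(\mathsf{A})=\operatorname{rank}(\varphi(\mathsf{A}))$. A CPD (CANDECOMP/PARAFAC decomposition) of a tensor $\mathsf{X}\in\mathbb{R}^{L_1\times\cdots\times L_M}$ is an expression $\mathsf{X}=\sum_{r=1}^R\lambda_r\,\mathbf{a}_r^{(1)}\circ\cdots\circ\mathbf{a}_r^{(M)}$, where $\circ$ is the outer product, $\lambda_1\ge\cdots\ge\lambda_R>0$, and each $\mathbf{a}_r^{(n)}\in\mathbb{R}^{L_n}$ has unit length; $R$ is the CP rank if it is the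 minimum integer for which such an expression exists. The factor matrices are $\mathbf{A}^{(n)}=[\mathbf{a}_1^{(n)}\ \cdots\ \mathbf{a}_R^{(n)}]\in\mathbb{R}^{L_n\times R}$. Here $M=2N$ and $(L_1,L_2,\dots,L_{2N-1},L_{2N})=(J_1,I_1,\dots,J_N,I_N)$. The $k$-rank $k_{\mathbf{M}}$ of a matrix $\mathbf{M}$ is the largest integer $k$ such that every set of $k$ columns of $\mathbf{M}$ is linearly independent. *)

theory Defs
  imports Complex_Main "Jordan_Normal_Form.DL_Rank"
begin

text \<open>
  An order-\<open>M\<close> tensor with mode sizes \<open>L 1, \<dots>, L M\<close> is a function on multi-indices. Modes are
  numbered from 1, entries within a mode (and the rank-one terms of a decomposition) from 0, as in
  the matrix library. Only the values on \<open>tensor_index M L\<close> are meaningful.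
\<close>

type_synonym tensor = "(nat \<Rightarrow> nat) \<Rightarrow> real"

definition tensor_index :: "nat \<Rightarrow> (nat \<Rightarrow> nat) \<Rightarrow> (nat \<Rightarrow> nat) set" where
  "tensor_index M L = (\<Pi>\<^sub>E n\<in>{1..M}. {..<L n})"

definition outer_prod :: "nat \<Rightarrow> (nat \<Rightarrow> real vec) \<Rightarrow> tensor" where
  "outer_prod M a = (\<lambda>x. \<Prod>n\<in>{1..M}. a n $ x n)"

text \<open>The decomposition is given by its weights \<open>lam\<close> and its factor matrices \<open>F 1, \<dots>, F M\<close>.\<close>

definition is_cpd ::
  "nat \<Rightarrow> (nat \<Rightarrow> nat) \<Rightarrow> tensor \<Rightarrow> nat \<Rightarrow> (nat \<Rightarrow> real) \<Rightarrow> (nat \<Rightarrow> real mat) \<Rightarrow> bool" where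
  "is_cpd M L X R lam F \<longleftrightarrow>
     (\<forall>r<R. lam r > 0) \<and>
     (\<forall>r s. r \<le> s \<longrightarrow> s < R \<longrightarrow> lam s \<le> lam r) \<and>
     (\<forall>n\<in>{1..M}. F n \<in> carrier_mat (L n) R) \<and>
     (\<forall>n\<in>{1..M}. \<forall>r<R. sqrt (col (F n) r \<bullet> col (F n) r) = 1) \<and>
     (\<forall>x\<in>tensor_index M L. X x = (\<Sum>r<R. lam r * outer_prod M (\<lambda>n. col (F n) r) x))"

definition cp_rank :: "nat \<Rightarrow> (nat \<Rightarrow> nat) \<Rightarrow> tensor \<Rightarrow> nat" where
  "cp_rank M L X = (LEAST R. \<exists>lam F. is_cpd M L X R lam F)"

text \<open>
  A set of columns is a set of column positions, so that repeated columns count as dependent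
  (hence the injectivity). Without the bound by the number of columns the condition would hold
  vacuously for all larger \<open>k\<close>.
\<close>

definition k_rank :: "real mat \<Rightarrow> nat" where
  "k_rank B = Max {k. k \<le> dim_col B \<and>
     (\<forall>S\<subseteq>{..<dim_col B}. card S = k \<longrightarrow>
        inj_on (col B) S \<and>
        LinearCombinations.module.lin_indpt class_ring
          (module_vec TYPE(real) (dim_row B)) (col B ` S))}"

text \<open>
  An even-order paired tensor has order \<open>2 * N\<close> and its modes have sizes
  \<open>J 1, I 1, \<dots>, J N, I N\<close>; \<open>interleave\<close> is used both for these sizes and for the multi-indices.
\<close>

definition interleave :: "(nat \<Rightarrow> nat) \<Rightarrow> (nat \<Rightarrow> nat) \<Rightarrow> nat \<Rightarrow> nat" where
  "interleave j i n = (if odd n then j ((n + 1) div 2) else i (n div 2))"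

definition paired_index :: "nat \<Rightarrow> (nat \<Rightarrow> nat) \<Rightarrow> (nat \<Rightarrow> nat) \<Rightarrow> nat \<Rightarrow> nat" where
  "paired_index N j i = restrict (interleave j i) {1..2*N}"

text \<open>
  The \<open>p\<close>-th multi-index, first index varying fastest: the mixed-radix digits of \<open>p\<close>, that is, the
  \<open>j n < J n\<close> with \<open>p = j 1 + j 2 * J 1 + j 3 * (J 1 * J 2) + \<dots>\<close>.
\<close>

definition multi_index :: "(nat \<Rightarrow> nat) \<Rightarrow> nat \<Rightarrow> nat \<Rightarrow> nat" where
  "multi_index J p n = (p div (\<Prod>k\<in>{1..<n}. J k)) mod J n"

definition unfolding_mat :: "nat \<Rightarrow> (nat \<Rightarrow> nat) \<Rightarrow> (nat \<Rightarrow> nat) \<Rightarrow> tensor \<Rightarrow> real mat" where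
  "unfolding_mat N J I A =
     mat (\<Prod>n\<in>{1..N}. J n) (\<Prod>n\<in>{1..N}. I n)
       (\<lambda>(p, q). A (paired_index N (multi_index J p) (multi_index I q)))"

definition rank_U :: "nat \<Rightarrow> (nat \<Rightarrow> nat) \<Rightarrow> (nat \<Rightarrow> nat) \<Rightarrow> tensor \<Rightarrow> nat" where
  "rank_U N J I A = vec_space.rank (\<Prod>n\<in>{1..N}. J n) (unfolding_mat N J I A)"

end

theory Submission
  imports Defs
begin

text \<open>
  The unfolding factors as \<open>U D V\<^sup>T\<close>, where \<open>U\<close> and \<open>V\<close> are the Khatri--Rao products of the odd and of
  the even factor matrices and \<open>D\<close> is the diagonal matrix of the weights, so it suffices to find left
  inverses of \<open>U\<close> and \<open>V\<close>. Fix a column position \<open>s\<close>. By the bound on the sum of the \<open>k\<close>-ranks, the other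
  \<open>R - 1\<close> positions are covered by sets of sizes \<open>k\<^sub>n - 1\<close>, one for each factor. In the \<open>n\<close>-th factor the
  columns in that set together with column \<open>s\<close> are independent, so some vector has inner product 1
  with column \<open>s\<close> and 0 with the rest of the set. The tensor product of these vectors is row \<open>s\<close> of the
  left inverse.
\<close>

section \<open>Ranks of products and one-sided inverses\<close>

lemma (in vec_space) mult_mat_vec_in_span_cols:
  assumes "A \<in> carrier_mat n k" "v \<in> carrier_vec k"
  shows "A *\<^sub>v v \<in> span (set (cols A))"
proof -
  have len: "v \<in> carrier_vec (length (cols A))"
    using assms by auto
  have "\<And>i. i < length (cols A) \<Longrightarrow> cols A ! i \<in> carrier_vec n"
    using assms by auto
  from mat_of_cols_mult_as_finsum[OF len this]
  have "mat_of_cols n (cols A) *\<^sub>v v =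
      lincomb (\<lambda>l. \<Sum>i = 0..<length (cols A). if l = cols A ! i then v $ i else 0) (set (cols A))"
    by simp
  moreover have "mat_of_cols n (cols A) = A"
    using assms by auto
  ultimately show ?thesis
    unfolding span_def by auto
qed

text \<open>Each column of \<open>A * B\<close> is \<open>A\<close> applied to a column of
  \<open>B\<close>, so the column space of the product is a subspace of that of \<open>A\<close>,
  and dimension is monotone.\<close>

lemma (in vec_space) rank_mult_le:
  assumes A: "A \<in> carrier_mat n k" and B: "B \<in> carrier_mat k m"
  shows "rank (A * B) \<le> rank A"
proof -
  have AB: "A * B \<in> carrier_mat n m"
    using A B by simp
  have colsA: "set (cols A) \<subseteq> carrier_vec n" and colsAB: "set (cols (A * B)) \<subseteq> carrier_vec n"
    using A AB cols_dim[of A] cols_dim[of "A * B"] by simp_all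
  have sub: "set (cols (A * B)) \<subseteq> span (set (cols A))"
  proof
    fix v assume "v \<in> set (cols (A * B))"
    then obtain j where j: "j < m" and v: "v = col (A * B) j"
      using AB by (auto simp: cols_def)
    have "v = A *\<^sub>v col B j"
      using v j A B by (intro eq_vecI) auto
    then show "v \<in> span (set (cols A))"
      using mult_mat_vec_in_span_cols[OF A, of "col B j"] j B by auto
  qed
  have "submodule class_ring (span (set (cols A))) V"
    using colsA by (rule span_is_submodule)
  with sub have "span (set (cols (A * B))) \<subseteq> span (set (cols A))"
    by (rule span_is_subset)
  moreover have spA: "subspace class_ring (span (set (cols A))) V"
    and spAB: "subspace class_ring (span (set (cols (A * B)))) V"
    using colsA colsAB by (auto intro: span_is_subspace)
  ultimately have nested: "subspace class_ring (span (set (cols (A * B)))) (vs (span (set (cols A))))"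
    by (intro nested_subspaces)
  have "vectorspace.fin_dim class_ring (span_vs (set (cols A)))"
    "vectorspace.fin_dim class_ring (span_vs (set (cols (A * B))))"
    using A AB fin_dim_span_cols by auto
  then show ?thesis
    unfolding rank_def
    using vectorspace.subspace_dim[OF subspace_is_vs[OF spA] nested] by auto
qed

lemma (in vec_space) rank_of_left_inverse:
  assumes A: "A \<in> carrier_mat n k" and W: "W \<in> carrier_mat k n" and WA: "W * A = 1\<^sub>m k"
  shows "rank A = k"
proof -
  have inj: "v = 0\<^sub>v k" if v: "v \<in> carrier_vec k" and "A *\<^sub>v v = 0\<^sub>v n" for v
  proof -
    have "v = (W * A) *\<^sub>v v"
      using v WA by simp
    also have "\<dots> = W *\<^sub>v (A *\<^sub>v v)"
      using A W v by simp
    also have "\<dots> = 0\<^sub>v k"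
      using that W by (intro eq_vecI) auto
    finally show ?thesis .
  qed
  \<comment> \<open>Independence is stated for the set of columns, which would hide a repeated
    column; two equal columns of \<open>A\<close> would give two equal columns of the
    identity.\<close>
  have distinct: "distinct (cols A)"
  proof (rule ccontr)
    assume "\<not> distinct (cols A)"
    then obtain i j where ij: "i < k" "j < k" "i \<noteq> j" "col A i = col A j"
      using A by (auto simp: distinct_conv_nth)
    have "(W * A) $$ (i, i) = (W * A) $$ (i, j)"
      using ij A W by simp
    then show False
      using ij WA by simp
  qed
  moreover have "lin_indpt (set (cols A))"
    using lin_depE[OF A _ distinct] inj by metis
  ultimately show ?thesis
    by (rule lin_indpt_full_rank[OF A])
qed

text \<open>Multiplying \<open>A * B\<close> by \<open>Z\<close> recovers \<open>A\<close>, which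
  has full column rank \<open>k\<close> because of \<open>W\<close>; so passing from
  \<open>A\<close> to \<open>A * B\<close> loses no rank.\<close>

lemma (in vec_space) rank_mult_of_inverses:
  assumes A: "A \<in> carrier_mat n k" and W: "W \<in> carrier_mat k n" and WA: "W * A = 1\<^sub>m k"
    and B: "B \<in> carrier_mat k m" and Z: "Z \<in> carrier_mat m k" and BZ: "B * Z = 1\<^sub>m k"
  shows "rank (A * B) = k"
proof (rule antisym)
  have k: "rank A = k"
    using A W WA by (rule rank_of_left_inverse)
  then show "rank (A * B) \<le> k"
    using rank_mult_le[OF A B] by simp
  have "A = (A * B) * Z"
    using A B Z BZ by simp
  then show "k \<le> rank (A * B)"
    using rank_mult_le[OF mult_carrier_mat[OF A B] Z] k by simp
qed

lemma (in vec_space) lin_indpt_empty: "lin_indpt {}"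
  unfolding lin_dep_def by auto

section \<open>The k-rank and dual vectors\<close>

text \<open>The maximum that defines the k-rank is attained: the candidates are bounded by the
  number of columns, and 0 is one of them because the empty set is independent.\<close>

lemma k_rank_in_set:
  fixes B :: "real mat"
  defines "indep S \<equiv> inj_on (col B) S \<and> LinearCombinations.module.lin_indpt class_ring
      (module_vec TYPE(real) (dim_row B)) (col B ` S)"
  shows "k_rank B \<le> dim_col B"
    and "S \<subseteq> {..<dim_col B} \<Longrightarrow> card S = k_rank B \<Longrightarrow> indep S"
proof -
  define K where "K = {k. k \<le> dim_col B \<and> (\<forall>S\<subseteq>{..<dim_col B}. card S = k \<longrightarrow> indep S)}"
  have "indep {}"
    unfolding indep_def using vec_space.lin_indpt_empty by auto
  moreover have "S = {}" if "S \<subseteq> {..<dim_col B}" "card S = 0" for S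
    using that finite_subset by fastforce
  ultimately have "0 \<in> K"
    by (auto simp: K_def)
  moreover have "finite K"
    by (simp add: K_def)
  ultimately have "Max K \<in> K"
    by (intro Max_in) auto
  then have "k_rank B \<in> K"
    unfolding k_rank_def K_def indep_def .
  then show "k_rank B \<le> dim_col B"
    and "S \<subseteq> {..<dim_col B} \<Longrightarrow> card S = k_rank B \<Longrightarrow> indep S"
    by (auto simp: K_def)
qed

text \<open>The definition speaks only of sets of exactly \<open>k_rank B\<close> columns. A smaller
  set extends to one of that size, and subsets of independent sets are independent. The coordinate
  form indexes coefficients by column positions instead of vectors.\<close>

lemma k_rank_independent:
  fixes B :: "real mat"
  assumes S: "S \<subseteq> {..<dim_col B}" "card S \<le> k_rank B"
    and zero: "\<And>i. i < dim_row B \<Longrightarrow> (\<Sum>r\<in>S. c r * B $$ (i, r)) = 0"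
    and r: "r \<in> S"
  shows "c r = 0"
proof -
  interpret vec_space "TYPE(real)" "dim_row B" .
  have "k_rank B \<le> card {..<dim_col B}"
    using k_rank_in_set(1) by simp
  then obtain T where T: "S \<subseteq> T" "T \<subseteq> {..<dim_col B}" "card T = k_rank B"
    using exists_subset_between[of S "k_rank B" "{..<dim_col B}"] S by auto
  have inj: "inj_on (col B) T" and indpt: "lin_indpt (col B ` T)"
    using k_rank_in_set(2)[OF T(2,3)] by auto
  have fin: "finite S"
    using S finite_subset by blast
  \<comment> \<open>\<open>lincomb\<close> attaches coefficients to vectors, so \<open>c\<close> is
    carried over from positions along the inverse of \<open>col B\<close>, which is injective on
    \<open>T\<close>.\<close>
  define a where "a v = c (the_inv_into T (col B) v)" for v
  have a: "a (col B r) = c r" if "r \<in> S" for r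
    unfolding a_def using that T(1) inj by (simp add: subset_iff the_inv_into_f_f)
  have injS: "inj_on (col B) S"
    using inj T(1) by (rule inj_on_subset)
  have carr: "col B ` S \<subseteq> carrier_vec (dim_row B)"
    by auto
  have "lincomb a (col B ` S) = 0\<^sub>v (dim_row B)"
  proof (rule eq_vecI)
    fix i assume "i < dim_vec (0\<^sub>v (dim_row B) :: real vec)"
    then have i: "i < dim_row B"
      by simp
    have "lincomb a (col B ` S) $ i = (\<Sum>r\<in>S. a (col B r) * col B r $ i)"
      using lincomb_index[OF i carr] injS by (simp add: sum.reindex)
    also have "\<dots> = (\<Sum>r\<in>S. c r * B $$ (i, r))"
      using S(1) i by (intro sum.cong) (auto simp: a)
    finally show "lincomb a (col B ` S) $ i = 0\<^sub>v (dim_row B) $ i"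
      using zero i by simp
  qed (use carr fin lincomb_dim in auto)
  then have "a (col B r) = 0"
    using not_lindepD[OF indpt, of "col B ` S" a] fin T(1) r by auto
  then show ?thesis
    using a r by simp
qed

text \<open>
  The Gram matrix of the columns in \<open>S\<close>, padded by the identity outside \<open>S\<close>, is invertible; the dual
  vector is a combination of these columns with coefficients from its inverse.
\<close>

lemma k_rank_dual_vector:
  fixes B :: "real mat"
  assumes S: "S \<subseteq> {..<dim_col B}" "card S \<le> k_rank B" and s: "s \<in> S"
  obtains w where "\<And>r. r \<in> S \<Longrightarrow> (\<Sum>i<dim_row B. w i * B $$ (i, r)) = (if r = s then 1 else 0)"
proof -
  define k where "k = dim_col B"
  define g where "g r t = (\<Sum>i<dim_row B. B $$ (i, r) * B $$ (i, t))" for r t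
  define G where "G = mat k k (\<lambda>(r, t). if r \<in> S then if t \<in> S then g r t else 0
    else if r = t then 1 else (0 :: real))"
  have G: "G \<in> carrier_mat k k"
    by (simp add: G_def)
  have Sk: "S \<subseteq> {..<k}"
    using S(1) by (simp add: k_def)
  have G_S: "(G *\<^sub>v v) $ r = (\<Sum>t\<in>S. g r t * v $ t)" if "r \<in> S" "v \<in> carrier_vec k" for r v
  proof -
    have "(G *\<^sub>v v) $ r = (\<Sum>t<k. (if t \<in> S then g r t else 0) * v $ t)"
      using that Sk by (auto simp: G_def scalar_prod_def lessThan_atLeast0 intro!: sum.cong)
    also have "\<dots> = (\<Sum>t\<in>S. g r t * v $ t)"
      using Sk by (intro sum.mono_neutral_cong_right) auto
    finally show ?thesis .
  qed
  have G_not_S: "(G *\<^sub>v v) $ r = v $ r" if "r \<notin> S" "r < k" "v \<in> carrier_vec k" for r v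
  proof -
    have "(G *\<^sub>v v) $ r = (\<Sum>t<k. (if r = t then 1 else 0) * v $ t)"
      using that by (simp add: G_def scalar_prod_def lessThan_atLeast0)
    also have "\<dots> = (\<Sum>t<k. if r = t then v $ t else 0)"
      by (intro sum.cong) auto
    finally show ?thesis
      using that by simp
  qed
  \<comment> \<open>A Gram row applied to \<open>v\<close> is the inner product of column
    \<open>r\<close> with the combination of the columns with coefficients \<open>v\<close>.\<close>
  have combine: "(\<Sum>t\<in>S. g r t * v $ t) = (\<Sum>i<dim_row B. (\<Sum>t\<in>S. v $ t * B $$ (i, t)) * B $$ (i, r))"
    for r and v :: "real vec"
    unfolding g_def sum_distrib_right by (subst sum.swap) (simp add: mult_ac)
  have "v = 0\<^sub>v k" if v: "v \<in> carrier_vec k" and Gv: "G *\<^sub>v v = 0\<^sub>v k" for v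
  proof (rule eq_vecI)
    fix r assume "r < dim_vec (0\<^sub>v k :: real vec)"
    then have r: "r < k"
      by simp
    show "v $ r = 0\<^sub>v k $ r"
    proof (cases "r \<in> S")
      case False
      then show ?thesis
        using G_not_S[OF False r v] Gv r by simp
    next
      case True
      \<comment> \<open>If \<open>G\<close> kills \<open>v\<close>, the squared length of the
        combination \<open>u\<close> equals the quadratic form of the Gram matrix at
        \<open>v\<close>, which is 0. So \<open>u\<close> vanishes, and independence kills the
        coefficients in \<open>S\<close>.\<close>
      define u where "u i = (\<Sum>t\<in>S. v $ t * B $$ (i, t))" for i
      have "(u i)\<^sup>2 = (\<Sum>t\<in>S. v $ t * (u i * B $$ (i, t)))" for i
      proof -
        have "u i * u i = u i * (\<Sum>t\<in>S. v $ t * B $$ (i, t))"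
          by (simp only: u_def)
        then show ?thesis
          by (simp add: power2_eq_square sum_distrib_left mult.left_commute)
      qed
      then have "(\<Sum>i<dim_row B. (u i)\<^sup>2) = (\<Sum>t\<in>S. v $ t * (\<Sum>i<dim_row B. u i * B $$ (i, t)))"
        by (simp add: sum_distrib_left sum.swap[of _ S])
      also have "\<dots> = (\<Sum>t\<in>S. v $ t * (G *\<^sub>v v) $ t)"
        using G_S[OF _ v] by (intro sum.cong) (simp_all add: combine u_def)
      also have "\<dots> = 0"
        using Gv Sk by (intro sum.neutral) auto
      finally have "\<forall>i\<in>{..<dim_row B}. (u i)\<^sup>2 = 0"
        by (subst (asm) sum_nonneg_eq_0_iff) auto
      then have "(\<Sum>t\<in>S. v $ t * B $$ (i, t)) = 0" if "i < dim_row B" for i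
        using that by (simp add: u_def)
      then show ?thesis
        using k_rank_independent[OF S _ True, of "\<lambda>t. v $ t"] r by simp
    qed
  qed (use v in simp)
  then have "det G \<noteq> 0"
    using det_0_iff_vec_prod_zero_field[OF G] by blast
  then obtain H where H: "H \<in> carrier_mat k k" "G * H = 1\<^sub>m k"
    using det_non_zero_imp_unit[OF G, of "()"] by (auto simp: Units_def ring_mat_def)
  define x where "x = H *\<^sub>v unit_vec k s"
  have x: "x \<in> carrier_vec k" and "G *\<^sub>v x = (G * H) *\<^sub>v unit_vec k s"
    using G H(1) by (simp_all add: x_def)
  then have Gx: "G *\<^sub>v x = unit_vec k s"
    using H(2) by simp
  show thesis
  proof
    fix r assume r: "r \<in> S"
    have "(\<Sum>i<dim_row B. (\<Sum>t\<in>S. x $ t * B $$ (i, t)) * B $$ (i, r)) = (G *\<^sub>v x) $ r"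
      using G_S[OF r x] combine by simp
    also have "\<dots> = (if r = s then 1 else 0)"
      using Gx r s Sk by (simp add: subset_iff)
    finally show "(\<Sum>i<dim_row B. (\<Sum>t\<in>S. x $ t * B $$ (i, t)) * B $$ (i, r))
      = (if r = s then 1 else 0)" .
  qed
qed

text \<open>Greedy choice: the set for \<open>m\<close> takes as many elements as its capacity
  \<open>a m\<close> allows, and what is left fits into the remaining capacities.\<close>

lemma cover_by_small_sets:
  fixes a :: "'a \<Rightarrow> nat"
  assumes "finite M" "finite T" "card T \<le> (\<Sum>n\<in>M. a n)"
  obtains U where "T = (\<Union>n\<in>M. U n)" "\<And>n. n \<in> M \<Longrightarrow> card (U n) \<le> a n"
proof -
  have "\<exists>U. T = (\<Union>n\<in>M. U n) \<and> (\<forall>n\<in>M. card (U n) \<le> a n)"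
    using assms
  proof (induction M arbitrary: T rule: finite_induct)
    case empty
    then show ?case by simp
  next
    case (insert m M)
    obtain V where V: "V \<subseteq> T" "card V = min (a m) (card T)"
      using obtain_subset_with_card_n[of "min (a m) (card T)" T] by auto
    have "card (T - V) \<le> (\<Sum>n\<in>M. a n)"
      using V insert by (simp add: card_Diff_subset finite_subset)
    then obtain U where U: "T - V = (\<Union>n\<in>M. U n)" "\<forall>n\<in>M. card (U n) \<le> a n"
      using insert.IH[of "T - V"] insert.prems by auto
    have "T = (\<Union>n\<in>insert m M. (U(m := V)) n)"
      using U(1) V(1) insert.hyps by auto
    moreover have "\<forall>n\<in>insert m M. card ((U(m := V)) n) \<le> a n"
      using U(2) V(2) by auto
    ultimately show ?case
      by blast
  qed
  then show ?thesis
    using that by blast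
qed

section \<open>Sums over mixed-radix digits\<close>

lemma multi_index_less:
  assumes "p < (\<Prod>n\<in>{1..N}. J n)" "n \<in> {1..N}"
  shows "multi_index J p n < J n"
proof -
  have "J n \<noteq> 0"
  proof
    assume "J n = 0"
    then have "(\<Prod>n\<in>{1..N}. J n) = 0"
      using assms(2) by (intro prod_zero) auto
    then show False
      using assms(1) by (metis not_less_zero)
  qed
  then show ?thesis
    by (simp add: multi_index_def)
qed

text \<open>This is the distributive law, since the digits of \<open>p\<close> run through every
  multi-index exactly once. In the induction step \<open>p = b + a * P\<close> with \<open>P\<close>
  the product of the first \<open>N\<close> sizes: \<open>a\<close> is the top digit and
  \<open>b\<close> carries the others.\<close>

lemma sum_prod_multi_index:
  fixes g :: "nat \<Rightarrow> nat \<Rightarrow> 'a :: comm_semiring_1"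
  shows "(\<Sum>p<(\<Prod>n\<in>{1..N}. J n). \<Prod>n\<in>{1..N}. g n (multi_index J p n)) =
    (\<Prod>n\<in>{1..N}. \<Sum>j<J n. g n j)"
proof (induction N)
  case 0
  then show ?case by simp
next
  case (Suc N)
  let ?P = "\<Prod>n\<in>{1..N}. J n"
  let ?h = "\<lambda>p. \<Prod>n\<in>{1..Suc N}. g n (multi_index J p n)"
  \<comment> \<open>\<open>P\<close> is a multiple of \<open>J n\<close> times the place value of
    digit \<open>n\<close>, so the shift disappears modulo \<open>J n\<close>. If a mode of size 0
    makes the place value 0, division by 0 gives 0 on both sides.\<close>
  have low: "multi_index J (b + a * ?P) n = multi_index J b n" if "n \<in> {1..N}" for a b n
  proof -
    have "{1..N} = {1..<n} \<union> {n} \<union> {n<..N}"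
      using that by auto
    then have "?P = (\<Prod>k\<in>{1..<n} \<union> {n} \<union> {n<..N}. J k)"
      by simp
    also have "\<dots> = (\<Prod>k\<in>{1..<n}. J k) * J n * (\<Prod>k\<in>{n<..N}. J k)"
    proof -
      have "({1..<n} \<union> {n}) \<inter> {n<..N} = {}" "{1..<n} \<inter> {n} = {}"
        by auto
      then show ?thesis
        by (simp add: prod.union_disjoint del: Un_insert_right)
    qed
    finally have P: "?P = (\<Prod>k\<in>{1..<n}. J k) * J n * (\<Prod>k\<in>{n<..N}. J k)" .
    show ?thesis
    proof (cases "(\<Prod>k\<in>{1..<n}. J k) = 0")
      case True
      then show ?thesis
        by (simp only: multi_index_def div_by_0)
    next
      case False
      have "b + a * ?P = b + (J n * (a * (\<Prod>k\<in>{n<..N}. J k))) * (\<Prod>k\<in>{1..<n}. J k)"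
        by (simp only: P mult_ac)
      then show ?thesis
        by (simp only: multi_index_def div_mult_self1[OF False] mod_mult_self4)
    qed
  qed
  have high: "multi_index J (b + a * ?P) (Suc N) = a" if "b < ?P" "a < J (Suc N)" for a b
  proof -
    have "?P \<noteq> 0"
      using that(1) by (metis not_less_zero)
    then have "(b + a * ?P) div ?P = a"
      using that(1) by (metis div_mult_self1 div_less add_0_right)
    then show ?thesis
      by (simp only: multi_index_def atLeastLessThanSuc_atLeastAtMost mod_less[OF that(2)])
  qed
  have split: "?h (b + a * ?P) = (\<Prod>n\<in>{1..N}. g n (multi_index J b n)) * g (Suc N) a"
    if "b < ?P" "a < J (Suc N)" for a b
  proof -
    have "?h (b + a * ?P) = (\<Prod>n\<in>{1..N}. g n (multi_index J (b + a * ?P) n)) *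
        g (Suc N) (multi_index J (b + a * ?P) (Suc N))"
      by simp
    also have "\<dots> = (\<Prod>n\<in>{1..N}. g n (multi_index J b n)) * g (Suc N) a"
      unfolding high[OF that] by (simp only: low cong: prod.cong)
    finally show ?thesis .
  qed
  have shift: "(\<Sum>p = a * ?P..<a * ?P + ?P. ?h p) = (\<Sum>b<?P. ?h (b + a * ?P))" for a
    using sum.shift_bounds_nat_ivl[of ?h 0 "a * ?P" ?P] by (simp add: lessThan_atLeast0 add.commute)
  have total: "(\<Prod>n\<in>{1..Suc N}. J n) = J (Suc N) * ?P"
    by (simp add: mult.commute)
  \<comment> \<open>The range is cut into \<open>J (Suc N)\<close> consecutive blocks of length
    \<open>P\<close>, one for each top digit.\<close>
  have "(\<Sum>p<(\<Prod>n\<in>{1..Suc N}. J n). ?h p) = (\<Sum>a<J (Suc N). \<Sum>p = a * ?P..<a * ?P + ?P. ?h p)"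
    unfolding total by (rule sum.nat_group[symmetric])
  also have "\<dots> = (\<Sum>a<J (Suc N). \<Sum>b<?P. (\<Prod>n\<in>{1..N}. g n (multi_index J b n)) * g (Suc N) a)"
    unfolding shift by (intro sum.cong refl) (simp only: split lessThan_iff)
  also have "\<dots> = (\<Prod>n\<in>{1..N}. \<Sum>j<J n. g n j) * (\<Sum>a<J (Suc N). g (Suc N) a)"
    by (simp only: Suc.IH[symmetric] sum_product) (rule sum.swap)
  finally show ?case
    by simp
qed

section \<open>Left inverses of Khatri--Rao products\<close>

text \<open>Column \<open>r\<close> is the Kronecker product of the \<open>r\<close>-th columns of
  the factors, with rows enumerated as in the unfolding, first index fastest.\<close>

definition khatri_rao :: "nat \<Rightarrow> (nat \<Rightarrow> nat) \<Rightarrow> nat \<Rightarrow> (nat \<Rightarrow> real mat) \<Rightarrow> real mat" where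
  "khatri_rao N K R G = mat (\<Prod>n\<in>{1..N}. K n) R (\<lambda>(p, r). \<Prod>n\<in>{1..N}. G n $$ (multi_index K p n, r))"

lemma khatri_rao_left_inverse:
  fixes G :: "nat \<Rightarrow> real mat"
  assumes G: "\<And>n. n \<in> {1..N} \<Longrightarrow> G n \<in> carrier_mat (K n) R"
    and pos: "\<And>n. n \<in> {1..N} \<Longrightarrow> k_rank (G n) \<ge> 1"
    and sum_ge: "(\<Sum>n\<in>{1..N}. k_rank (G n)) \<ge> R + N - 1"
  obtains W where "W \<in> carrier_mat R (\<Prod>n\<in>{1..N}. K n)" "W * khatri_rao N K R G = 1\<^sub>m R"
proof -
  \<comment> \<open>One place per mode is reserved for column \<open>s\<close>, which leaves
    \<open>k_rank (G n) - 1\<close> for the other columns. As every k-rank is at least 1, the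
    truncated subtraction is exact.\<close>
  have "(\<Sum>n\<in>{1..N}. k_rank (G n)) = (\<Sum>n\<in>{1..N}. (k_rank (G n) - 1) + 1)"
    using pos by (intro sum.cong refl) (metis le_add_diff_inverse2)
  also have "\<dots> = (\<Sum>n\<in>{1..N}. k_rank (G n) - 1) + N"
    by (subst sum.distrib) simp
  finally have excess: "R - 1 \<le> (\<Sum>n\<in>{1..N}. k_rank (G n) - 1)"
    using sum_ge by linarith
  have "\<forall>s\<in>{..<R}. \<exists>w. \<forall>r<R.
      (\<Prod>n\<in>{1..N}. \<Sum>i<K n. w n i * G n $$ (i, r)) = (if r = s then 1 else 0)"
  proof
    fix s assume "s \<in> {..<R}"
    then have s: "s < R"
      by simp
    have "card ({..<R} - {s}) \<le> (\<Sum>n\<in>{1..N}. k_rank (G n) - 1)"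
      using s excess by simp
    then obtain U where U: "{..<R} - {s} = (\<Union>n\<in>{1..N}. U n)"
        "\<And>n. n \<in> {1..N} \<Longrightarrow> card (U n) \<le> k_rank (G n) - 1"
      using cover_by_small_sets[of "{1..N}" "{..<R} - {s}"] by auto
    have "\<forall>n\<in>{1..N}. \<exists>w. \<forall>r\<in>insert s (U n).
        (\<Sum>i<K n. w i * G n $$ (i, r)) = (if r = s then 1 else 0)"
    proof
      fix n assume n: "n \<in> {1..N}"
      have dims: "dim_row (G n) = K n" "dim_col (G n) = R"
        using G[OF n] by auto
      have "insert s (U n) \<subseteq> {..<dim_col (G n)}"
        using U(1) n s dims by blast
      moreover have "card (insert s (U n)) \<le> k_rank (G n)"
        using U(2)[OF n] pos[OF n] card_insert_le_m1[of "k_rank (G n)" "U n" s] by simp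
      ultimately show "\<exists>w. \<forall>r\<in>insert s (U n).
          (\<Sum>i<K n. w i * G n $$ (i, r)) = (if r = s then 1 else 0)"
        using k_rank_dual_vector[of "insert s (U n)" "G n" s] dims by (metis insertI1)
    qed
    from bchoice[OF this] obtain w where w: "\<forall>n\<in>{1..N}. \<forall>r\<in>insert s (U n).
        (\<Sum>i<K n. w n i * G n $$ (i, r)) = (if r = s then 1 else 0)" ..
    \<comment> \<open>For \<open>r = s\<close> every factor is 1. For \<open>r \<noteq> s\<close>
      the cover provides one mode whose factor is 0, whatever the values in the other modes.\<close>
    have "(\<Prod>n\<in>{1..N}. \<Sum>i<K n. w n i * G n $$ (i, r)) = (if r = s then 1 else 0)" if r: "r < R" for r
    proof (cases "r = s")
      case True
      then show ?thesis
        using w by (auto intro!: prod.neutral)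
    next
      case False
      then obtain n where n: "n \<in> {1..N}" "r \<in> U n"
        using U(1) r by blast
      then have "(\<Sum>i<K n. w n i * G n $$ (i, r)) = 0"
        using w False by simp
      then have "(\<Prod>n\<in>{1..N}. \<Sum>i<K n. w n i * G n $$ (i, r)) = 0"
        using n(1) by (intro prod_zero) auto
      then show ?thesis
        using False by simp
    qed
    then show "\<exists>w. \<forall>r<R.
        (\<Prod>n\<in>{1..N}. \<Sum>i<K n. w n i * G n $$ (i, r)) = (if r = s then 1 else 0)"
      by blast
  qed
  from bchoice[OF this] obtain w where w: "\<forall>s\<in>{..<R}. \<forall>r<R.
      (\<Prod>n\<in>{1..N}. \<Sum>i<K n. w s n i * G n $$ (i, r)) = (if r = s then 1 else 0)" ..
  define W where "W = mat R (\<Prod>n\<in>{1..N}. K n) (\<lambda>(s, p). \<Prod>n\<in>{1..N}. w s n (multi_index K p n))"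
  have "W * khatri_rao N K R G = 1\<^sub>m R"
  proof (rule eq_matI)
    fix s r assume "s < dim_row (1\<^sub>m R :: real mat)" "r < dim_col (1\<^sub>m R :: real mat)"
    then have sr: "s < R" "r < R"
      by auto
    have "(W * khatri_rao N K R G) $$ (s, r) = (\<Sum>p<(\<Prod>n\<in>{1..N}. K n).
        \<Prod>n\<in>{1..N}. w s n (multi_index K p n) * G n $$ (multi_index K p n, r))"
      using sr by (simp add: W_def khatri_rao_def scalar_prod_def lessThan_atLeast0 prod.distrib)
    \<comment> \<open>The inner product of two Kronecker products is the product of the modewise
      inner products.\<close>
    also have "\<dots> = (\<Prod>n\<in>{1..N}. \<Sum>i<K n. w s n i * G n $$ (i, r))"
      using sum_prod_multi_index[where g = "\<lambda>n i. w s n i * G n $$ (i, r)"] by simp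
    finally show "(W * khatri_rao N K R G) $$ (s, r) = 1\<^sub>m R $$ (s, r)"
      using w sr by auto
  qed (simp_all add: W_def khatri_rao_def)
  moreover have "W \<in> carrier_mat R (\<Prod>n\<in>{1..N}. K n)"
    by (simp add: W_def)
  ultimately show ?thesis
    using that by blast
qed

section \<open>Factorisation of the unfolding\<close>

lemma sum_odd_upto: "(\<Sum>n\<in>{n\<in>{1..2 * N}. odd n}. f n) = (\<Sum>m\<in>{1..N :: nat}. f (2 * m - 1))"
  by (rule sum.reindex_bij_witness[of _ "\<lambda>m. 2 * m - 1" "\<lambda>n. (n + 1) div 2"]) (auto elim!: oddE)

lemma sum_even_upto: "(\<Sum>n\<in>{n\<in>{1..2 * N}. even n}. f n) = (\<Sum>m\<in>{1..N :: nat}. f (2 * m))"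
  by (rule sum.reindex_bij_witness[of _ "\<lambda>m. 2 * m" "\<lambda>n. n div 2"]) auto

lemma prod_upto_double:
  fixes f :: "nat \<Rightarrow> 'a :: comm_monoid_mult"
  shows "(\<Prod>n\<in>{1..2 * N}. f n) = (\<Prod>m\<in>{1..N}. f (2 * m - 1)) * (\<Prod>m\<in>{1..N}. f (2 * m))"
  by (induction N) (simp_all add: mult_ac)

lemma interleave_odd: "m \<ge> 1 \<Longrightarrow> interleave j i (2 * m - 1) = j m"
  and interleave_even: "interleave j i (2 * m) = i m"
  by (auto simp: interleave_def)

text \<open>The decomposition determines the tensor only on \<open>tensor_index\<close>, whose
  members are extensional; the restriction in \<open>paired_index\<close> provides for this.\<close>

lemma paired_index_in_tensor_index:
  assumes "\<And>n. n \<in> {1..N} \<Longrightarrow> j n < J n" "\<And>n. n \<in> {1..N} \<Longrightarrow> i n < I n"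
  shows "paired_index N j i \<in> tensor_index (2 * N) (interleave J I)"
  unfolding paired_index_def tensor_index_def
  using assms by (auto simp: interleave_def elim!: oddE evenE)

text \<open>The row index fixes the odd modes and the column index the even ones, so each rank-one
  term splits into a row part and a column part. The weights are absorbed into the right factor,
  leaving a product of two matrices.\<close>

lemma unfolding_mat_cpd:
  assumes cpd: "is_cpd (2 * N) (interleave J I) A R lam F"
  shows "unfolding_mat N J I A = khatri_rao N J R (\<lambda>m. F (2 * m - 1)) *
    mat R (\<Prod>n\<in>{1..N}. I n) (\<lambda>(r, q). lam r * khatri_rao N I R (\<lambda>m. F (2 * m)) $$ (q, r))"
    (is "_ = ?U * ?M")
proof (rule eq_matI)
  fix p q assume "p < dim_row (?U * ?M)" "q < dim_col (?U * ?M)"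
  then have p: "p < (\<Prod>n\<in>{1..N}. J n)" and q: "q < (\<Prod>n\<in>{1..N}. I n)"
    by (simp_all add: khatri_rao_def)
  define j i where "j = multi_index J p" and "i = multi_index I q"
  have j: "j n < J n" and i: "i n < I n" if "n \<in> {1..N}" for n
    using multi_index_less that p q by (auto simp: i_def j_def)
  have F: "F n \<in> carrier_mat (interleave J I n) R" if "n \<in> {1..2 * N}" for n
    using cpd that by (auto simp: is_cpd_def)
  have outer: "outer_prod (2 * N) (\<lambda>n. col (F n) r) (paired_index N j i) =
      (\<Prod>m\<in>{1..N}. F (2 * m - 1) $$ (j m, r)) * (\<Prod>m\<in>{1..N}. F (2 * m) $$ (i m, r))"
    if r: "r < R" for r
  proof -
    have "col (F (2 * m - 1)) r $ paired_index N j i (2 * m - 1) = F (2 * m - 1) $$ (j m, r)"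
      if "m \<in> {1..N}" for m
      using F[of "2 * m - 1"] interleave_odd[of m] that r j by (auto simp: paired_index_def)
    moreover have "col (F (2 * m)) r $ paired_index N j i (2 * m) = F (2 * m) $$ (i m, r)"
      if "m \<in> {1..N}" for m
      using F[of "2 * m"] that r i by (auto simp: paired_index_def interleave_even)
    ultimately show ?thesis
      unfolding outer_prod_def prod_upto_double by (metis (no_types, lifting) prod.cong)
  qed
  have "unfolding_mat N J I A $$ (p, q) = A (paired_index N j i)"
    using p q by (simp add: unfolding_mat_def i_def j_def)
  also have "\<dots> = (\<Sum>r<R. lam r * outer_prod (2 * N) (\<lambda>n. col (F n) r) (paired_index N j i))"
    using cpd paired_index_in_tensor_index[of N j J i I] i j by (auto simp: is_cpd_def)
  also have "\<dots> = (\<Sum>r<R. ?U $$ (p, r) * ?M $$ (r, q))"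
    using p q by (intro sum.cong) (simp_all add: outer khatri_rao_def flip: i_def j_def)
  also have "\<dots> = (?U * ?M) $$ (p, q)"
    using p q by (simp add: khatri_rao_def scalar_prod_def lessThan_atLeast0)
  finally show "unfolding_mat N J I A $$ (p, q) = (?U * ?M) $$ (p, q)" .
qed (simp_all add: unfolding_mat_def khatri_rao_def)

section \<open>The rank of the unfolding\<close>

theorem proposition4p7:
  fixes N R :: nat and J I :: "nat \<Rightarrow> nat" and A :: tensor
    and lam :: "nat \<Rightarrow> real" and F :: "nat \<Rightarrow> real mat"
  assumes "N \<ge> 1"
    and "is_cpd (2 * N) (interleave J I) A R lam F"
    and "cp_rank (2 * N) (interleave J I) A = R"
    and "\<forall>n\<in>{1..2 * N}. k_rank (F n) \<ge> 1"
    and "(\<Sum>n\<in>{n\<in>{1..2 * N}. odd n}. k_rank (F n)) \<ge> R + N - 1"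
    and "(\<Sum>n\<in>{n\<in>{1..2 * N}. even n}. k_rank (F n)) \<ge> R + N - 1"
  shows "rank_U N J I A = R"
proof -
  have F: "F n \<in> carrier_mat (interleave J I n) R" if "n \<in> {1..2 * N}" for n
    using assms(2) that by (auto simp: is_cpd_def)
  have lam: "lam r > 0" if "r < R" for r
    using assms(2) that by (auto simp: is_cpd_def)
  let ?U = "khatri_rao N J R (\<lambda>m. F (2 * m - 1))" and ?V = "khatri_rao N I R (\<lambda>m. F (2 * m))"
  let ?P = "\<Prod>n\<in>{1..N}. J n" and ?Q = "\<Prod>n\<in>{1..N}. I n"
  have odd_mode: "2 * m - 1 \<in> {1..2 * N}" if "m \<in> {1..N}" for m
    using that by auto
  have "F (2 * m - 1) \<in> carrier_mat (J m) R" if "m \<in> {1..N}" for m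
    using F[OF odd_mode[OF that]] interleave_odd[of m J I] that by simp
  moreover have "k_rank (F (2 * m - 1)) \<ge> 1" if "m \<in> {1..N}" for m
    using assms(4) odd_mode[OF that] by blast
  ultimately obtain W where W: "W \<in> carrier_mat R ?P" "W * ?U = 1\<^sub>m R"
    using assms(5) unfolding sum_odd_upto by (rule khatri_rao_left_inverse)
  have "F (2 * m) \<in> carrier_mat (I m) R" if "m \<in> {1..N}" for m
    using F[of "2 * m"] that by (auto simp: interleave_even)
  moreover have "k_rank (F (2 * m)) \<ge> 1" if "m \<in> {1..N}" for m
    using assms(4) that by auto
  ultimately obtain Y where Y: "Y \<in> carrier_mat R ?Q" "Y * ?V = 1\<^sub>m R"
    using assms(6) unfolding sum_even_upto by (rule khatri_rao_left_inverse)
  let ?M = "mat R ?Q (\<lambda>(r, q). lam r * ?V $$ (q, r))"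
  \<comment> \<open>With \<open>D\<close> the diagonal matrix of the weights, \<open>?M\<close> is
    \<open>D V^T\<close> and \<open>Z\<close> is \<open>Y^T D^(-1)\<close>. Hence
    \<open>?M * Z\<close> is \<open>D (Y V)^T D^(-1)\<close>, the identity; positivity of the
    weights permits the division.\<close>
  define Z where "Z = mat ?Q R (\<lambda>(q, r). Y $$ (r, q) / lam r)"
  have "?M * Z = 1\<^sub>m R"
  proof (rule eq_matI)
    fix r s assume "r < dim_row (1\<^sub>m R :: real mat)" "s < dim_col (1\<^sub>m R :: real mat)"
    then have rs: "r < R" "s < R"
      by auto
    have "(?M * Z) $$ (r, s) = (\<Sum>q<?Q. lam r / lam s * (Y $$ (s, q) * ?V $$ (q, r)))"
      using rs by (simp add: Z_def scalar_prod_def lessThan_atLeast0 mult_ac)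
    also have "\<dots> = lam r / lam s * (Y * ?V) $$ (s, r)"
      using rs Y(1) by (simp add: khatri_rao_def scalar_prod_def lessThan_atLeast0 sum_distrib_left)
    finally show "(?M * Z) $$ (r, s) = 1\<^sub>m R $$ (r, s)"
      using rs Y(2) lam[OF rs(1)] by auto
  qed (simp_all add: Z_def)
  moreover have "?U \<in> carrier_mat ?P R" "?M \<in> carrier_mat R ?Q" "Z \<in> carrier_mat ?Q R"
    by (simp_all add: khatri_rao_def Z_def)
  ultimately show ?thesis
    unfolding rank_U_def unfolding_mat_cpd[OF assms(2)]
    using W by (intro vec_space.rank_mult_of_inverses)
qed

end
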